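(* Let $k\in\mathbb{N}$ and $\ell\in\{1,3,5,7,9,11\}$, and let $S=\langle 4,\ 12k+\ell\rangle$. Then \[ O(S)=\begin{cases} 24k^3+30k^2+11k+1 & \text{if } \ell=1,\\ 24k^3+42k^2+23k+4 & \text{if } \ell=3,\\ 24k^3+54k^2+39k+9 & \text{if } \ell=5,\\ 24k^3+66k^2+59k+17 & \text{if } \ell=7,\\ 24k^3+78k^2+83k+29 & \text{if } \ell=9,\\ 24k^3+90k^2+111k+45 & \text{if } \ell=11. \end{cases} \]
   Context: $\mathbb{N}=\{0,1,2,\dots\}$. A numerical semigroup is a subset of $\mathbb{N}$ that contains $0$, has finite complement in $\mathbb{N}$, and is closed under addition. $\langle n_1,\dots,n_t\rangle=\{\sum_i a_i n_i : a_i\in\mathbb{N}\}$. For a numerical semigroup $S$, $O(S)$ is the number of oversemigroups of $S$, i.e. the number of numerical semigroups $T$ with $T\supseteq S$ (including $T=S$ and $T=\mathbb{N}$). *)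

theory Defs
  imports Main
begin

definition numerical_semigroup :: "nat set \<Rightarrow> bool" where
  "numerical_semigroup S \<longleftrightarrow>
     0 \<in> S \<and> finite (- S) \<and> (\<forall>x\<in>S. \<forall>y\<in>S. x + y \<in> S)"

definition generated :: "nat list \<Rightarrow> nat set" where
  "generated ns = {\<Sum>i<length ns. a i * ns ! i | a :: nat \<Rightarrow> nat. True}"

definition oversemigroups :: "nat set \<Rightarrow> nat set set" where
  "oversemigroups S = {T. numerical_semigroup T \<and> S \<subseteq> T}"

(* For a numerical semigroup S this set is finite, since T is determined by a
   subset of the finite complement of S; so card is the true number of elements. *)
definition num_oversemigroups :: "nat set \<Rightarrow> nat" where
  "num_oversemigroups S = card (oversemigroups S)"

end

theory Submission
  imports Defs
begin

text \<open>
  A numerical semigroup \<open>T\<close> containing \<open>4\<close> is determined by the numbers \<open>a\<close>, \<open>b\<close>, \<open>c\<close> for which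
  \<open>4 a + 1\<close>, \<open>4 b + 2\<close>, \<open>4 c + 3\<close> are its least elements in the nonzero residue classes modulo
  \<open>4\<close>; closure under addition becomes \<open>b \<le> 2 a\<close>, \<open>b \<le> 2 c + 1\<close>, \<open>c \<le> a + b\<close>, \<open>a \<le> b + c + 1\<close>
  (Kunz coordinates). Such a \<open>T\<close> contains \<open>12 k + l\<close> iff \<open>a \<le> n\<close> or \<open>c \<le> n\<close>, depending on
  \<open>l\<close> modulo \<open>4\<close>, where \<open>n = (12 k + l) div 4\<close>. For fixed \<open>a\<close> (or \<open>c\<close>) and \<open>b\<close> the remaining
  coordinate runs through an interval, and summing the interval lengths gives a function that is
  quadratic on each residue class of \<open>a\<close> (or \<open>c\<close>) modulo \<open>3\<close>.
\<close>

section \<open>Semigroups containing 4\<close>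

text \<open>The list is indexed by the residue modulo 4; its leading 0 puts every multiple of 4 into
  the set.\<close>

definition of_kunz :: "nat \<times> nat \<times> nat \<Rightarrow> nat set" where
  "of_kunz = (\<lambda>(a, b, c). {n. [0, a, b, c] ! (n mod 4) \<le> n div 4})"

text \<open>The inequalities come from the residue sums 1+1, 3+3, 1+2 and 2+3, in this order; each
  \<open>+ 1\<close> is the carry when the sum exceeds 4. The sums 1+3 and 2+2 land in class 0 and
  impose nothing.\<close>

definition kunz :: "(nat \<times> nat \<times> nat) set" where
  "kunz = {(a, b, c). b \<le> 2 * a \<and> b \<le> 2 * c + 1 \<and> c \<le> a + b \<and> a \<le> b + c + 1}"

lemma of_kunz_iff:
  "4 * q \<in> of_kunz (a, b, c)"
  "4 * q + 1 \<in> of_kunz (a, b, c) \<longleftrightarrow> a \<le> q"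
  "4 * q + 2 \<in> of_kunz (a, b, c) \<longleftrightarrow> b \<le> q"
  "4 * q + 3 \<in> of_kunz (a, b, c) \<longleftrightarrow> c \<le> q"
proof -
  have "(4 * q + 1) mod 4 = 1" "(4 * q + 1) div 4 = q" by presburger+
  moreover have "(4 * q + 2) mod 4 = 2" "(4 * q + 2) div 4 = q" by presburger+
  moreover have "(4 * q + 3) mod 4 = 3" "(4 * q + 3) div 4 = q" by presburger+
  ultimately show
    "4 * q \<in> of_kunz (a, b, c)"
    "4 * q + 1 \<in> of_kunz (a, b, c) \<longleftrightarrow> a \<le> q"
    "4 * q + 2 \<in> of_kunz (a, b, c) \<longleftrightarrow> b \<le> q"
    "4 * q + 3 \<in> of_kunz (a, b, c) \<longleftrightarrow> c \<le> q"
    by (simp_all add: of_kunz_def)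
qed

lemma mod_4_cases:
  fixes n :: nat
  obtains q where "n = 4 * q" | q where "n = 4 * q + 1"
    | q where "n = 4 * q + 2" | q where "n = 4 * q + 3"
proof -
  have "n = 4 * (n div 4) \<or> n = 4 * (n div 4) + 1 \<or> n = 4 * (n div 4) + 2 \<or> n = 4 * (n div 4) + 3"
    by presburger
  then show thesis using that by blast
qed

lemma inj_of_kunz: "inj of_kunz"
proof (rule injI)
  fix p p' :: "nat \<times> nat \<times> nat"
  assume eq: "of_kunz p = of_kunz p'"
  obtain a b c a' b' c' where p: "p = (a, b, c)" "p' = (a', b', c')"
    by (cases p, cases p') auto
  have "a \<le> q \<longleftrightarrow> a' \<le> q" "b \<le> q \<longleftrightarrow> b' \<le> q" "c \<le> q \<longleftrightarrow> c' \<le> q" for q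
    using eq of_kunz_iff(2-4) p by metis+
  then have "a = a'" "b = b'" "c = c'"
    by (meson dual_order.refl order_antisym)+
  then show "p = p'" by (simp add: p)
qed

lemma numerical_semigroup_of_kunz:
  assumes "p \<in> kunz"
  shows "numerical_semigroup (of_kunz p)"
proof -
  obtain a b c where p: "p = (a, b, c)" by (cases p) auto
  have ineqs: "b \<le> 2 * a" "b \<le> 2 * c + 1" "c \<le> a + b" "a \<le> b + c + 1"
    using assms by (auto simp: kunz_def p)
  let ?T = "of_kunz (a, b, c)"
  have "x < 4 * (a + b + c + 1)" if "x \<notin> ?T" for x
    using that by (cases x rule: mod_4_cases) (auto simp only: of_kunz_iff not_le, simp_all)
  then have "- ?T \<subseteq> {..<4 * (a + b + c + 1)}" by auto
  then have "finite (- ?T)" using finite_subset by blast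
  moreover have "x + y \<in> ?T" if "x \<in> ?T" "y \<in> ?T" for x y
  proof -
    \<comment> \<open>Carry table: each sum is brought to the form quotient and residue, so that
      \<open>of_kunz_iff\<close> turns closure into linear inequalities.\<close>
    have sums: "4 * q + (4 * r + i) = 4 * (q + r) + i" "4 * q + i + 4 * r = 4 * (q + r) + i"
      "4 * q + 1 + (4 * r + 1) = 4 * (q + r) + 2"
      "4 * q + 1 + (4 * r + 2) = 4 * (q + r) + 3"
      "4 * q + 2 + (4 * r + 1) = 4 * (q + r) + 3"
      "4 * q + 1 + (4 * r + 3) = 4 * (q + r + 1)"
      "4 * q + 3 + (4 * r + 1) = 4 * (q + r + 1)"
      "4 * q + 2 + (4 * r + 2) = 4 * (q + r + 1)"
      "4 * q + 2 + (4 * r + 3) = 4 * (q + r + 1) + 1"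
      "4 * q + 3 + (4 * r + 2) = 4 * (q + r + 1) + 1"
      "4 * q + 3 + (4 * r + 3) = 4 * (q + r + 1) + 2"
      "4 * q + 4 * r = 4 * (q + r)" for q r i :: nat
      by simp_all
    show ?thesis
      using that ineqs
      by (cases x rule: mod_4_cases; cases y rule: mod_4_cases; hypsubst)
        (simp_all only: sums of_kunz_iff)
  qed
  moreover have "0 \<in> ?T" using of_kunz_iff(1)[of 0] by simp
  ultimately show ?thesis by (auto simp: numerical_semigroup_def p)
qed

section \<open>From a semigroup back to its Kunz coordinates\<close>

lemma numerical_semigroup_mult:
  assumes "numerical_semigroup T" "x \<in> T"
  shows "a * x \<in> T"
  using assms by (induction a) (auto simp: numerical_semigroup_def)

text \<open>Cofiniteness makes the progression meet \<open>T\<close>, and adding multiples of 4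
  preserves membership, so the least admissible quotient is a threshold.\<close>

lemma residue_class_threshold:
  assumes T: "numerical_semigroup T" "4 \<in> T"
  obtains a where "\<And>q. 4 * q + i \<in> T \<longleftrightarrow> a \<le> q"
proof
  fix q
  let ?P = "\<lambda>q. 4 * q + i \<in> T"
  have "\<exists>q. ?P q"
  proof (rule ccontr)
    assume "\<nexists>q. ?P q"
    then have "range (\<lambda>q. 4 * q + i) \<subseteq> - T" by auto
    moreover have "infinite (range (\<lambda>q. 4 * q + i))"
      by (simp add: finite_image_iff inj_def)
    ultimately show False
      using T finite_subset unfolding numerical_semigroup_def by blast
  qed
  then have least: "?P (LEAST q. ?P q)" by (rule LeastI_ex)
  show "?P q \<longleftrightarrow> (LEAST q. ?P q) \<le> q"
  proof
    show "?P q \<Longrightarrow> (LEAST q. ?P q) \<le> q" by (rule Least_le)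
    assume le: "(LEAST q. ?P q) \<le> q"
    have "(q - (LEAST q. ?P q)) * 4 + (4 * (LEAST q. ?P q) + i) \<in> T"
      using T least numerical_semigroup_mult[of T 4] by (auto simp: numerical_semigroup_def)
    also have "(q - (LEAST q. ?P q)) * 4 + (4 * (LEAST q. ?P q) + i) = 4 * q + i"
      using le by simp
    finally show "?P q" .
  qed
qed

lemma of_kunz_exhaust:
  assumes T: "numerical_semigroup T" "4 \<in> T"
  shows "\<exists>p\<in>kunz. T = of_kunz p"
proof -
  obtain a where a: "\<And>q. 4 * q + 1 \<in> T \<longleftrightarrow> a \<le> q" using residue_class_threshold[OF T] by blast
  obtain b where b: "\<And>q. 4 * q + 2 \<in> T \<longleftrightarrow> b \<le> q" using residue_class_threshold[OF T] by blast
  obtain c where c: "\<And>q. 4 * q + 3 \<in> T \<longleftrightarrow> c \<le> q" using residue_class_threshold[OF T] by blast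
  have mult: "4 * q \<in> T" for q
    using numerical_semigroup_mult[OF T, of q] by (simp add: mult.commute)
  have "n \<in> T \<longleftrightarrow> n \<in> of_kunz (a, b, c)" for n
    by (cases n rule: mod_4_cases) (simp_all only: a b c mult of_kunz_iff)
  then have eq: "T = of_kunz (a, b, c)" by blast
  have add: "x + y \<in> T" if "x \<in> T" "y \<in> T" for x y
    using T that by (auto simp: numerical_semigroup_def)
  have mem: "4 * a + 1 \<in> T" "4 * b + 2 \<in> T" "4 * c + 3 \<in> T"
    by (simp_all only: a b c order_refl)
  \<comment> \<open>Sums of least elements lie in \<open>T\<close>; comparing their quotients with
    the thresholds yields the four inequalities of \<open>kunz\<close>.\<close>
  have split: "4 * (2 * a) + 2 = (4 * a + 1) + (4 * a + 1)"
    "4 * (2 * c + 1) + 2 = (4 * c + 3) + (4 * c + 3)"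
    "4 * (a + b) + 3 = (4 * a + 1) + (4 * b + 2)"
    "4 * (b + c + 1) + 1 = (4 * b + 2) + (4 * c + 3)"
    by simp_all
  have "4 * (2 * a) + 2 \<in> T" "4 * (2 * c + 1) + 2 \<in> T"
    "4 * (a + b) + 3 \<in> T" "4 * (b + c + 1) + 1 \<in> T"
    by (simp_all only: split add mem)
  then have "(a, b, c) \<in> kunz" by (simp only: a b c kunz_def) simp
  with eq show ?thesis by blast
qed

section \<open>Oversemigroups as Kunz triples\<close>

lemma generated_subset_iff:
  assumes T: "numerical_semigroup T"
  shows "generated [x, y] \<subseteq> T \<longleftrightarrow> x \<in> T \<and> y \<in> T"
proof -
  have gen: "generated [x, y] = {a 0 * x + a 1 * y | a :: nat \<Rightarrow> nat. True}"
    by (simp add: generated_def numeral_2_eq_2 lessThan_Suc add.commute)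
  have "x \<in> generated [x, y]"
    unfolding gen by (rule CollectI, rule exI[of _ "\<lambda>i. if i = 0 then 1 else 0"]) simp
  moreover have "y \<in> generated [x, y]"
    unfolding gen by (rule CollectI, rule exI[of _ "\<lambda>i. if i = 0 then 0 else 1"]) simp
  moreover have "generated [x, y] \<subseteq> T" if "x \<in> T" "y \<in> T"
    using T numerical_semigroup_mult[OF T] that
    by (auto simp: gen numerical_semigroup_def)
  ultimately show ?thesis by blast
qed

lemma num_oversemigroups_eq_card_kunz:
  "num_oversemigroups (generated [4, m]) = card {p \<in> kunz. m \<in> of_kunz p}"
proof -
  have four: "4 \<in> of_kunz p" for p
    using of_kunz_iff(1)[of 1] by (cases p) simp
  have "oversemigroups (generated [4, m]) = of_kunz ` {p \<in> kunz. m \<in> of_kunz p}"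
  proof (rule set_eqI)
    fix T
    have "T \<in> oversemigroups (generated [4, m]) \<longleftrightarrow> numerical_semigroup T \<and> 4 \<in> T \<and> m \<in> T"
      using generated_subset_iff by (auto simp: oversemigroups_def)
    also have "\<dots> \<longleftrightarrow> T \<in> of_kunz ` {p \<in> kunz. m \<in> of_kunz p}"
      using of_kunz_exhaust[of T] numerical_semigroup_of_kunz four by blast
    finally show "T \<in> oversemigroups (generated [4, m]) \<longleftrightarrow> T \<in> of_kunz ` {p \<in> kunz. m \<in> of_kunz p}" .
  qed
  then show ?thesis
    by (simp add: num_oversemigroups_def card_image inj_on_subset[OF inj_of_kunz])
qed

section \<open>Counting Kunz coordinates\<close>

text \<open>These sums correct the interval lengths in \<open>fiber_1_add\<close>. All terms with
  \<open>b > 2 * j\<close> truncate to 0, so any upper limit \<open>N\<close> from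
  \<open>2 * j\<close> on gives the same value.\<close>

lemma sum_truncated_1:
  fixes j N :: nat
  assumes "2 * j \<le> N"
  shows "(\<Sum>b\<le>N. 3 * j - (b + b div 2 + 1)) = 3 * j\<^sup>2"
    and "(\<Sum>b\<le>N. 3 * j + 1 - (b + b div 2 + 1)) = 3 * j\<^sup>2 + 2 * j"
    and "(\<Sum>b\<le>N. 3 * j + 2 - (b + b div 2 + 1)) = 3 * j\<^sup>2 + 4 * j + 1"
proof -
  \<comment> \<open>Raising \<open>b\<close> by 2 raises \<open>b + b div 2\<close> by 3; the terms
    split off at \<open>b = 0\<close> and \<open>b = 1\<close> are \<open>a + 2\<close> and
    \<open>a + 1\<close>.\<close>
  have step: "(\<Sum>b\<le>Suc (Suc M). a + 3 - (b + b div 2 + 1)) =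
      2 * a + 3 + (\<Sum>b\<le>M. a - (b + b div 2 + 1))" for M a :: nat
    by (simp add: sum.atMost_Suc_shift del: sum.atMost_Suc)
  have "(\<Sum>b\<le>N. 3 * j - (b + b div 2 + 1)) = 3 * j\<^sup>2 \<and>
      (\<Sum>b\<le>N. 3 * j + 1 - (b + b div 2 + 1)) = 3 * j\<^sup>2 + 2 * j \<and>
      (\<Sum>b\<le>N. 3 * j + 2 - (b + b div 2 + 1)) = 3 * j\<^sup>2 + 4 * j + 1"
    using assms
  proof (induction j arbitrary: N)
    case 0
    show ?case by (simp add: sum.atMost_shift)
  next
    case (Suc j)
    define M where "M = N - 2"
    with Suc.prems have N: "N = Suc (Suc M)" and M: "2 * j \<le> M" by simp_all
    have "3 * Suc j = 3 * j + 3" "3 * Suc j + 1 = 3 * j + 1 + 3" "3 * Suc j + 2 = 3 * j + 2 + 3"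
      by simp_all
    with Suc.IH[OF M] show ?case
      by (simp only: N step) (simp add: power2_eq_square algebra_simps)
  qed
  then show "(\<Sum>b\<le>N. 3 * j - (b + b div 2 + 1)) = 3 * j\<^sup>2"
    "(\<Sum>b\<le>N. 3 * j + 1 - (b + b div 2 + 1)) = 3 * j\<^sup>2 + 2 * j"
    "(\<Sum>b\<le>N. 3 * j + 2 - (b + b div 2 + 1)) = 3 * j\<^sup>2 + 4 * j + 1"
    by blast+
qed

lemma sum_truncated_3:
  fixes j N :: nat
  assumes "2 * j \<le> N"
  shows "(\<Sum>b\<le>N. 3 * j - (b + (b + 1) div 2)) = 3 * j\<^sup>2 + j"
    and "(\<Sum>b\<le>N. 3 * j + 1 - (b + (b + 1) div 2)) = 3 * j\<^sup>2 + 3 * j + 1"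
    and "(\<Sum>b\<le>N. 3 * j + 2 - (b + (b + 1) div 2)) = 3 * j\<^sup>2 + 5 * j + 2"
proof -
  \<comment> \<open>Here the terms split off are \<open>a + 3\<close> and
    \<open>a + 1\<close>.\<close>
  have step: "(\<Sum>b\<le>Suc (Suc M). a + 3 - (b + (b + 1) div 2)) =
      2 * a + 4 + (\<Sum>b\<le>M. a - (b + (b + 1) div 2))" for M a :: nat
    by (simp add: sum.atMost_Suc_shift del: sum.atMost_Suc)
  have "(\<Sum>b\<le>N. 3 * j - (b + (b + 1) div 2)) = 3 * j\<^sup>2 + j \<and>
      (\<Sum>b\<le>N. 3 * j + 1 - (b + (b + 1) div 2)) = 3 * j\<^sup>2 + 3 * j + 1 \<and>
      (\<Sum>b\<le>N. 3 * j + 2 - (b + (b + 1) div 2)) = 3 * j\<^sup>2 + 5 * j + 2"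
    using assms
  proof (induction j arbitrary: N)
    case 0
    show ?case by (simp add: sum.atMost_shift)
  next
    case (Suc j)
    define M where "M = N - 2"
    with Suc.prems have N: "N = Suc (Suc M)" and M: "2 * j \<le> M" by simp_all
    have "3 * Suc j = 3 * j + 3" "3 * Suc j + 1 = 3 * j + 1 + 3" "3 * Suc j + 2 = 3 * j + 2 + 3"
      by simp_all
    with Suc.IH[OF M] show ?case
      by (simp only: N step) (simp add: power2_eq_square algebra_simps)
  qed
  then show "(\<Sum>b\<le>N. 3 * j - (b + (b + 1) div 2)) = 3 * j\<^sup>2 + j"
    "(\<Sum>b\<le>N. 3 * j + 1 - (b + (b + 1) div 2)) = 3 * j\<^sup>2 + 3 * j + 1"
    "(\<Sum>b\<le>N. 3 * j + 2 - (b + (b + 1) div 2)) = 3 * j\<^sup>2 + 5 * j + 2"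
    by blast+
qed

text \<open>Counts the Kunz triples with first coordinate \<open>a\<close>; the interval holds the
  admissible \<open>c\<close>.\<close>

definition fiber_1 :: "nat \<Rightarrow> nat" where
  "fiber_1 a = (\<Sum>b\<le>2 * a. card {max (b div 2) (a - (b + 1))..a + b})"

text \<open>Counts the Kunz triples with third coordinate \<open>c\<close>; the interval holds the
  admissible \<open>a\<close>.\<close>

definition fiber_3 :: "nat \<Rightarrow> nat" where
  "fiber_3 c = (\<Sum>b\<le>2 * c + 1. card {max ((b + 1) div 2) (c - b)..b + c + 1})"

lemma card_kunz_1: "card {p \<in> kunz. 4 * n + 1 \<in> of_kunz p} = (\<Sum>a\<le>n. fiber_1 a)"
proof -
  have le: "b \<le> 2 * c + 1 \<longleftrightarrow> b div 2 \<le> c" for b c :: nat by presburger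
  let ?A = "SIGMA a:{..n}. SIGMA b:{..2 * a}. {max (b div 2) (a - (b + 1))..a + b}"
  have "p \<in> {p \<in> kunz. 4 * n + 1 \<in> of_kunz p} \<longleftrightarrow> p \<in> ?A" for p
  proof -
    obtain a b c where p: "p = (a, b, c)" by (cases p) auto
    show ?thesis by (simp only: p mem_Collect_eq of_kunz_iff) (auto simp: kunz_def le)
  qed
  then have "{p \<in> kunz. 4 * n + 1 \<in> of_kunz p} = ?A" by blast
  then show ?thesis by (simp add: fiber_1_def)
qed

lemma card_kunz_3: "card {p \<in> kunz. 4 * n + 3 \<in> of_kunz p} = (\<Sum>c\<le>n. fiber_3 c)"
proof -
  have le: "b \<le> 2 * a \<longleftrightarrow> (b + 1) div 2 \<le> a" for a b :: nat by presburger
  let ?A = "SIGMA c:{..n}. SIGMA b:{..2 * c + 1}. {max ((b + 1) div 2) (c - b)..b + c + 1}"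
  \<comment> \<open>The nested product enumerates \<open>c\<close> first; \<open>?f\<close> restores
    the coordinate order.\<close>
  let ?f = "\<lambda>(c, b, a). (a, b, c)"
  have "{p \<in> kunz. 4 * n + 3 \<in> of_kunz p} = ?f ` ?A"
  proof (rule set_eqI)
    fix p :: "nat \<times> nat \<times> nat"
    obtain a b c where p: "p = (a, b, c)" by (cases p) auto
    have "p \<in> ?f ` ?A \<longleftrightarrow> (c, b, a) \<in> ?A" by (force simp: p)
    also have "\<dots> \<longleftrightarrow> p \<in> {p \<in> kunz. 4 * n + 3 \<in> of_kunz p}"
      by (simp only: p mem_Collect_eq of_kunz_iff) (auto simp: kunz_def le)
    finally show "p \<in> {p \<in> kunz. 4 * n + 3 \<in> of_kunz p} \<longleftrightarrow> p \<in> ?f ` ?A" by simp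
  qed
  moreover have "inj_on ?f ?A" by (auto simp: inj_on_def)
  ultimately show ?thesis by (simp add: card_image fiber_3_def)
qed

text \<open>Since \<open>max u v = u + (v - u)\<close> in truncated arithmetic, adding
  \<open>v - u\<close> back leaves the length of the interval starting at
  \<open>u = b div 2\<close>, which sums without case distinction.\<close>

lemma fiber_1_add: "fiber_1 a + (\<Sum>b\<le>2 * a. a - (b + b div 2 + 1)) = 3 * a\<^sup>2 + 4 * a + 1"
proof -
  have "card {max (b div 2) (a - (b + 1))..a + b} + (a - (b + b div 2 + 1)) = a + 1 + (b + 1) div 2" for b
    by simp
  then have "fiber_1 a + (\<Sum>b\<le>2 * a. a - (b + b div 2 + 1)) = (\<Sum>b\<le>2 * a. a + 1 + (b + 1) div 2)"
    by (simp only: fiber_1_def flip: sum.distrib)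
  moreover have "(\<Sum>b\<le>2 * a. (b + 1) div 2) = a\<^sup>2 + a"
    by (induction a) (simp_all add: power2_eq_square)
  ultimately show ?thesis
    by (simp only: sum.distrib sum_constant card_atMost) (simp add: power2_eq_square algebra_simps)
qed

lemma fiber_3_add: "fiber_3 c + (\<Sum>b\<le>2 * c + 1. c - (b + (b + 1) div 2)) = 3 * c\<^sup>2 + 7 * c + 4"
proof -
  have "card {max ((b + 1) div 2) (c - b)..b + c + 1} + (c - (b + (b + 1) div 2)) = c + 2 + b div 2" for b
    by simp
  then have "fiber_3 c + (\<Sum>b\<le>2 * c + 1. c - (b + (b + 1) div 2)) = (\<Sum>b\<le>2 * c + 1. c + 2 + b div 2)"
    by (simp only: fiber_3_def flip: sum.distrib)
  moreover have "(\<Sum>b\<le>2 * c + 1. b div 2) = c\<^sup>2 + c"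
    by (induction c) (simp_all add: power2_eq_square)
  ultimately show ?thesis
    by (simp only: sum.distrib sum_constant card_atMost) (simp add: power2_eq_square algebra_simps)
qed

lemma fiber_1_eq:
  "fiber_1 (3 * j) = 24 * j\<^sup>2 + 12 * j + 1"
  "fiber_1 (3 * j + 1) = 24 * j\<^sup>2 + 28 * j + 8"
  "fiber_1 (3 * j + 2) = 24 * j\<^sup>2 + 44 * j + 20"
  using fiber_1_add[of "3 * j"] fiber_1_add[of "3 * j + 1"] fiber_1_add[of "3 * j + 2"]
    sum_truncated_1(1)[of j "2 * (3 * j)"] sum_truncated_1(2)[of j "2 * (3 * j + 1)"]
    sum_truncated_1(3)[of j "2 * (3 * j + 2)"]
  by (simp_all add: power2_eq_square algebra_simps)

lemma fiber_3_eq: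
  "fiber_3 (3 * j) = 24 * j\<^sup>2 + 20 * j + 4"
  "fiber_3 (3 * j + 1) = 24 * j\<^sup>2 + 36 * j + 13"
  "fiber_3 (3 * j + 2) = 24 * j\<^sup>2 + 52 * j + 28"
  using fiber_3_add[of "3 * j"] fiber_3_add[of "3 * j + 1"] fiber_3_add[of "3 * j + 2"]
    sum_truncated_3(1)[of j "2 * (3 * j) + 1"] sum_truncated_3(2)[of j "2 * (3 * j + 1) + 1"]
    sum_truncated_3(3)[of j "2 * (3 * j + 2) + 1"]
  by (simp_all add: power2_eq_square algebra_simps)

section \<open>Summing the fibers in blocks of three\<close>

lemma sum_atMost_three_mult:
  fixes f :: "nat \<Rightarrow> nat"
  shows "(\<Sum>a\<le>3 * Suc k. f a) =
    (\<Sum>a\<le>3 * k. f a) + f (3 * k + 1) + f (3 * k + 2) + f (3 * Suc k)"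
  by (simp add: numeral_3_eq_3)

lemma sum_fiber_1:
  "(\<Sum>a\<le>3 * k. fiber_1 a) = 24 * k^3 + 30 * k^2 + 11 * k + 1"
proof (induction k)
  case 0
  show ?case using fiber_1_eq(1)[of 0] by simp
next
  case (Suc k)
  show ?case
    by (simp only: sum_atMost_three_mult fiber_1_eq Suc)
      (simp add: power2_eq_square power3_eq_cube algebra_simps)
qed

lemma sum_fiber_3:
  "(\<Sum>c\<le>3 * k. fiber_3 c) = 24 * k^3 + 42 * k^2 + 23 * k + 4"
proof (induction k)
  case 0
  show ?case using fiber_3_eq(1)[of 0] by simp
next
  case (Suc k)
  show ?case
    by (simp only: sum_atMost_three_mult fiber_3_eq Suc)
      (simp add: power2_eq_square power3_eq_cube algebra_simps)
qed

lemma sum_atMost_three_mult_add: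
  fixes f :: "nat \<Rightarrow> nat"
  shows "(\<Sum>a\<le>3 * k + 1. f a) = (\<Sum>a\<le>3 * k. f a) + f (3 * k + 1)"
    and "(\<Sum>a\<le>3 * k + 2. f a) = (\<Sum>a\<le>3 * k. f a) + f (3 * k + 1) + f (3 * k + 2)"
  by simp_all

theorem theorem1p8:
  fixes k l :: nat and S :: "nat set"
  assumes "l \<in> {1, 3, 5, 7, 9, 11}"
    and "S = generated [4, 12 * k + l]"
  shows "num_oversemigroups S =
    (if l = 1 then 24 * k^3 + 30 * k^2 + 11 * k + 1
     else if l = 3 then 24 * k^3 + 42 * k^2 + 23 * k + 4
     else if l = 5 then 24 * k^3 + 54 * k^2 + 39 * k + 9
     else if l = 7 then 24 * k^3 + 66 * k^2 + 59 * k + 17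
     else if l = 9 then 24 * k^3 + 78 * k^2 + 83 * k + 29
     else 24 * k^3 + 90 * k^2 + 111 * k + 45)"
proof -
  have 1: "num_oversemigroups (generated [4, 4 * n + 1]) = (\<Sum>a\<le>n. fiber_1 a)" for n
    by (simp only: num_oversemigroups_eq_card_kunz card_kunz_1)
  have 3: "num_oversemigroups (generated [4, 4 * n + 3]) = (\<Sum>c\<le>n. fiber_3 c)" for n
    by (simp only: num_oversemigroups_eq_card_kunz card_kunz_3)
  \<comment> \<open>The bound on \<open>a\<close> or \<open>c\<close> is \<open>3 * k\<close>,
    \<open>3 * k + 1\<close> or \<open>3 * k + 2\<close>, so zero, one or two fibers are added to
    the sum up to \<open>3 * k\<close>.\<close>
  have arith: "12 * k + 1 = 4 * (3 * k) + 1" "12 * k + 3 = 4 * (3 * k) + 3"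
    "12 * k + 5 = 4 * (3 * k + 1) + 1" "12 * k + 7 = 4 * (3 * k + 1) + 3"
    "12 * k + 9 = 4 * (3 * k + 2) + 1" "12 * k + 11 = 4 * (3 * k + 2) + 3"
    by simp_all
  note eqs = 1 3 arith sum_atMost_three_mult_add sum_fiber_1 sum_fiber_3 fiber_1_eq fiber_3_eq
  consider "l = 1" | "l = 3" | "l = 5" | "l = 7" | "l = 9" | "l = 11"
    using assms(1) by blast
  then show ?thesis
    by cases (hypsubst, simp only: assms(2) eqs, simp)+
qed

end
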